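(* Let $n\geq 3$. The only hyperplane splits of the permutahedron $\Pi_n$ whose two maximal cells are both Bruhat interval polytopes are those given by the following hyperplanes: (T1) $x_1+x_2+\cdots+x_j=1+2+\cdots+(j-1)+(j+1)=\binom{j+1}{2}+1$, for $1\le j\leq n-2$; (T2) $x_1+x_2+\cdots+x_j=n+(n-1)+\cdots+(n-(j-2))+(n-j)$, for $1\le j\leq n-2$ (the right-hand side is the sum of the $j$ elements of $\{n-j\}\cup\{n-j+2,\dots,n\}$); (T3) $x_i=r$, where $2\leq r\leq n-1$ and $i\in\{1,n\}$. That is, if a split of $\Pi_n$ has maximal cells $F_1,F_2$ which are both Bruhat interval polytopes, then there is a hyperplane $H$ of type (T1), (T2) or (T3) such that $\{F_1,F_2\}=\{\Pi_n\cap H^{\geq},\Pi_n\cap H^{\leq}\}$.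
   Context: $\mathfrak{S}_n$ is the symmetric group. A permutation $z\in\mathfrak{S}_n$ with one-line notation $z_1z_2\cdots z_n$ (where $z_i=z(i)$) is identified with the point $(z_1,\dots,z_n)\in\mathbb{R}^n$. The permutahedron is $\Pi_n=\mathrm{conv}\{(z_1,\dots,z_n): z\in\mathfrak{S}_n\}$. $\leq$ denotes the (strong) Bruhat order on $\mathfrak{S}_n$. Bruhat interval polytope (BIP): for $u\leq v$ in Bruhat order, $P_{[u,v]}=\mathrm{conv}\{(z_1,\dots,z_n): u\leq z\leq v\}$. For a hyperplane $H:\sum a_ix_i=b$, put $H^{\geq}=\{p\in\mathbb{R}^n:\sum a_ip_i\geq b\}$ and $H^{\leq}=\{p\in\mathbb{R}^n:\sum a_ip_i\leq b\}$. A split of a polytope $P$ is a polytopal subdivision of $P$ without new vertices (all vertices of the cells are vertices of $P$) having exactly two maximal cells $F_1,F_2$; the intersection $F_1\cap F_2$ is a codimension 1 cell whose affine span is the split hyperplane. Since $\Pi_n$ lies in the hyperplane $x_1+\cdots+x_n=\binom{n+1}{2}$, split hyperplanes of $\Pi_n$ are considered up to their intersection with this affine span. *)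

theory Defs
  imports "HOL-Analysis.Analysis" "HOL-Combinatorics.Permutations"
begin

section \<open>Strong Bruhat order on the symmetric group\<close>

text \<open>Elements of the symmetric group are functions on \<open>nat\<close> that permute \<open>{1..n}\<close>.\<close>

definition inversions :: "nat \<Rightarrow> (nat \<Rightarrow> nat) \<Rightarrow> (nat \<times> nat) set" where
  "inversions n w = {(i, j). 1 \<le> i \<and> i < j \<and> j \<le> n \<and> w i > w j}"

definition perm_length :: "nat \<Rightarrow> (nat \<Rightarrow> nat) \<Rightarrow> nat" where
  "perm_length n w = card (inversions n w)"

definition bruhat_step :: "nat \<Rightarrow> (nat \<Rightarrow> nat) \<Rightarrow> (nat \<Rightarrow> nat) \<Rightarrow> bool" where
  "bruhat_step n u v \<longleftrightarrow>
     (\<exists>i\<in>{1..n}. \<exists>j\<in>{1..n}. i \<noteq> j \<and> v = u \<circ> Transposition.transpose i j) \<and>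
     perm_length n u < perm_length n v"

definition bruhat_le :: "nat \<Rightarrow> (nat \<Rightarrow> nat) \<Rightarrow> (nat \<Rightarrow> nat) \<Rightarrow> bool" where
  "bruhat_le n u v \<longleftrightarrow> u permutes {1..n} \<and> v permutes {1..n} \<and> (bruhat_step n)\<^sup>*\<^sup>* u v"

definition bruhat_interval :: "nat \<Rightarrow> (nat \<Rightarrow> nat) \<Rightarrow> (nat \<Rightarrow> nat) \<Rightarrow> (nat \<Rightarrow> nat) set" where
  "bruhat_interval n u v = {z. bruhat_le n u z \<and> bruhat_le n z v}"

section \<open>Permutahedra and Bruhat interval polytopes\<close>

text \<open>
  Euclidean \<open>n\<close>-space is \<open>real ^ 'n\<close> together with an enumeration \<open>e\<close>, a bijection from
  \<open>{1..n}\<close> onto the index type: the coordinate \<open>x\<^sub>i\<close> of a point \<open>x\<close> is \<open>x $ e i\<close>.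
\<close>

definition perm_point :: "nat \<Rightarrow> (nat \<Rightarrow> 'n) \<Rightarrow> (nat \<Rightarrow> nat) \<Rightarrow> real ^ 'n::finite" where
  "perm_point n e z = (\<Sum>i\<in>{1..n}. real (z i) *\<^sub>R axis (e i) 1)"

lemma perm_point_nth:
  assumes "bij_betw e {1..n} UNIV" and "i \<in> {1..n}"
  shows "perm_point n e z $ e i = real (z i)"
proof -
  have "perm_point n e z $ e i = (\<Sum>k\<in>{1..n}. if k = i then real (z k) else 0)"
    unfolding perm_point_def sum_component
  proof (rule sum.cong)
    fix k assume "k \<in> {1..n}"
    then have "e i = e k \<longleftrightarrow> i = k"
      using assms by (meson bij_betw_imp_inj_on inj_on_eq_iff)
    then show "(real (z k) *\<^sub>R axis (e k) 1) $ e i = (if k = i then real (z k) else 0)"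
      by (auto simp: axis_def)
  qed simp
  with assms(2) show ?thesis by simp
qed

definition permutahedron :: "nat \<Rightarrow> (nat \<Rightarrow> 'n) \<Rightarrow> (real ^ 'n::finite) set" where
  "permutahedron n e = convex hull (perm_point n e ` {z. z permutes {1..n}})"

definition bruhat_interval_polytope ::
    "nat \<Rightarrow> (nat \<Rightarrow> 'n) \<Rightarrow> (nat \<Rightarrow> nat) \<Rightarrow> (nat \<Rightarrow> nat) \<Rightarrow> (real ^ 'n::finite) set" where
  "bruhat_interval_polytope n e u v = convex hull (perm_point n e ` bruhat_interval n u v)"

definition is_BIP :: "nat \<Rightarrow> (nat \<Rightarrow> 'n) \<Rightarrow> (real ^ 'n::finite) set \<Rightarrow> bool" where
  "is_BIP n e F \<longleftrightarrow> (\<exists>u v. bruhat_le n u v \<and> F = bruhat_interval_polytope n e u v)"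

section \<open>Splits of polytopes\<close>

text \<open>The empty polytope is a face of every polytope, hence a cell of every nonempty complex.\<close>

definition polytopal_complex :: "'a::euclidean_space set set \<Rightarrow> bool" where
  "polytopal_complex \<C> \<longleftrightarrow>
     finite \<C> \<and>
     (\<forall>S\<in>\<C>. polytope S) \<and>
     (\<forall>S F. S \<in> \<C> \<and> F face_of S \<longrightarrow> F \<in> \<C>) \<and>
     (\<forall>S S'. S \<in> \<C> \<and> S' \<in> \<C> \<longrightarrow> (S \<inter> S') face_of S \<and> (S \<inter> S') face_of S')"

definition polytopal_subdivision :: "'a::euclidean_space set set \<Rightarrow> 'a set \<Rightarrow> bool" where
  "polytopal_subdivision \<C> P \<longleftrightarrow> polytopal_complex \<C> \<and> \<Union>\<C> = P"

definition maximal_cells :: "'a set set \<Rightarrow> 'a set set" where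
  "maximal_cells \<C> = {F \<in> \<C>. \<forall>G\<in>\<C>. F \<subseteq> G \<longrightarrow> G = F}"

text \<open>
  That the two maximal cells of a split meet in a cell of codimension 1 is a consequence of
  this definition, so it is not imposed.
\<close>

definition is_split :: "'a::euclidean_space set set \<Rightarrow> 'a set \<Rightarrow> bool" where
  "is_split \<C> P \<longleftrightarrow>
     polytopal_subdivision \<C> P \<and>
     (\<forall>F\<in>\<C>. \<forall>v. v extreme_point_of F \<longrightarrow> v extreme_point_of P) \<and>
     card (maximal_cells \<C>) = 2"

section \<open>The three families of hyperplanes\<close>

text \<open>A pair \<open>(a, b)\<close> stands for the hyperplane \<open>{x. a \<bullet> x = b}\<close>.\<close>

definition hyperplanes_T1 :: "nat \<Rightarrow> (nat \<Rightarrow> 'n) \<Rightarrow> ((real ^ 'n::finite) \<times> real) set" where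
  "hyperplanes_T1 n e =
     {((\<Sum>i\<in>{1..j}. axis (e i) 1), real ((j + 1) choose 2) + 1) | j. 1 \<le> j \<and> j \<le> n - 2}"

definition hyperplanes_T2 :: "nat \<Rightarrow> (nat \<Rightarrow> 'n) \<Rightarrow> ((real ^ 'n::finite) \<times> real) set" where
  "hyperplanes_T2 n e =
     {((\<Sum>i\<in>{1..j}. axis (e i) 1), (\<Sum>k\<in>{n - j} \<union> {n - j + 2..n}. real k)) | j.
        1 \<le> j \<and> j \<le> n - 2}"

definition hyperplanes_T3 :: "nat \<Rightarrow> (nat \<Rightarrow> 'n) \<Rightarrow> ((real ^ 'n::finite) \<times> real) set" where
  "hyperplanes_T3 n e =
     {(axis (e i) 1, real r) | i r. i \<in> {1, n} \<and> 2 \<le> r \<and> r \<le> n - 1}"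

end

theory Submission
  imports Defs
begin

text \<open>
  The two maximal cells \<open>F\<close> and \<open>G\<close> of a split are the parts of the permutahedron on the two sides
  of a hyperplane \<open>H = {x. a \<bullet> x = b}\<close> (\<open>convex_union_split_by_hyperplane\<close>). Name them so that \<open>F\<close>
  contains the identity; then \<open>F\<close> belongs to a lower interval \<open>[id, v]\<close>, \<open>G\<close> to some interval
  \<open>[u, w]\<close>, and \<open>F \<inter> G\<close> is the hull of the permutations common to both intervals.

  These common permutations all lie on \<open>H\<close> and are linked to \<open>u\<close> by Bruhat steps, which stay inside
  the common part because \<open>[id, v]\<close> is a lower set. A step exchanges the values at two positions
  \<open>i\<close> and \<open>k\<close>, so it can stay on \<open>H\<close> only if the coefficients of \<open>a\<close> at \<open>i\<close> and \<open>k\<close> agree. If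
  \<open>C\<close> is the set of positions where \<open>a\<close> has one given coefficient, the set of values on \<open>C\<close> is
  therefore the same for all common permutations. In particular the sum of the coordinates in \<open>C\<close>
  is constant on the section of the permutahedron by \<open>H\<close>. An affine function that vanishes on this
  section is a multiple of \<open>a \<bullet> x - b\<close> (\<open>affine_functional_multiple\<close>), so \<open>H\<close> can be given by a
  sum of coordinates over a block \<open>B\<close>, which is \<open>C\<close> or its complement, with an integer value
  \<open>\<beta>\<close> (\<open>BIP_halves_by_block\<close>).

  Two restrictions remain to be read off. First, every permutation with block sum at most \<open>\<beta>\<close> lies
  in the lower set \<open>[id, v]\<close>. If some position in \<open>B\<close> directly followed one outside \<open>B\<close>, a
  permutation of block sum \<open>\<beta>\<close> could be arranged to have a descent there, and removing the descent
  would go down in Bruhat order and up in block sum; hence \<open>B = {1..j}\<close>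
  (\<open>BIP_halves_block_initial\<close>). Secondly, every permutation with block sum exactly \<open>\<beta>\<close> is common to
  both intervals, so only one \<open>j\<close>-subset \<open>S\<close> of \<open>{1..n}\<close> has sum \<open>\<beta>\<close>, and \<open>\<beta>\<close> is neither the least
  nor the greatest sum. For \<open>2 \<le> j \<le> n - 2\<close> a subset that is alone with its sum, and not extreme, is one
  unit away from an extreme one (\<open>unique_subset_of_sum\<close>), which gives the first two families. For
  \<open>j = 1\<close> and \<open>j = n - 1\<close> the hyperplane is \<open>x\<^sub>1 = r\<close> or, by passing to the complement, \<open>x\<^sub>n = r\<close>.
\<close>

section \<open>Splitting a convex set by a hyperplane\<close>

text \<open>
  A supporting hyperplane of \<open>F\<close> that cuts out the face \<open>F \<inter> G\<close> must separate the two parts: a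
  segment from a point of \<open>F - G\<close> to a point of \<open>G\<close> on the same open side would be covered by two
  closed sets that do not meet on it, against connectedness. Points on the hyperplane itself belong
  to both parts as limits from the two sides.
\<close>

lemma convex_union_split_by_hyperplane:
  fixes K :: "'a::euclidean_space set"
  assumes "convex K" and K: "K = F \<union> G"
    and "polytope F" and "closed G"
    and face: "F \<inter> G face_of F"
    and FG: "\<not> F \<subseteq> G" and GF: "\<not> G \<subseteq> F"
  obtains a b p q where "F = K \<inter> {x. a \<bullet> x \<le> b}" and "G = K \<inter> {x. a \<bullet> x \<ge> b}"
    and "p \<in> K" and "a \<bullet> p < b" and "q \<in> K" and "a \<bullet> q > b"
proof -
  have clF: "closed F"
    using assms(3) polytope_imp_closed by blast
  have "F \<inter> G exposed_face_of F"
    using face exposed_face_of_polyhedron polytope_imp_polyhedron assms(3) by blast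
  then obtain a b where Fle: "F \<subseteq> {x. a \<bullet> x \<le> b}" and FGeq: "F \<inter> G = F \<inter> {x. a \<bullet> x = b}"
    unfolding exposed_face_of_def by blast
  obtain p where p: "p \<in> F" "p \<notin> G" using FG by blast
  obtain q where q: "q \<in> G" "q \<notin> F" using GF by blast
  have hp: "a \<bullet> p < b" using p Fle FGeq by force
  have below: "x \<notin> G" if "a \<bullet> x < b" for x
  proof
    assume "x \<in> G"
    have sub: "closed_segment p x \<subseteq> F \<union> G"
      using closed_segment_subset[of p K x] p \<open>x \<in> G\<close> \<open>convex K\<close> K by blast
    have "closed_segment p x \<subseteq> {y. a \<bullet> y < b}"
      using closed_segment_subset[of p "{y. a \<bullet> y < b}" x] convex_halfspace_lt hp that by blast
    then have "F \<inter> G \<inter> closed_segment p x = {}"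
      unfolding FGeq by force
    then show False
      using connected_segment(1)[of p x] p(1) \<open>x \<in> G\<close> sub clF \<open>closed G\<close>
      unfolding connected_closed by blast
  qed
  have le: "x \<in> F" if "x \<in> K" "a \<bullet> x \<le> b" for x
  proof (cases "a \<bullet> x < b")
    case True
    then show ?thesis using below K that by blast
  next
    case False
    with hp that have "p \<noteq> x" "a \<bullet> x = b" by auto
    have "open_segment p x \<subseteq> F"
    proof
      fix y assume y: "y \<in> open_segment p x"
      then obtain t where t: "0 < t" "t < 1" "y = (1 - t) *\<^sub>R p + t *\<^sub>R x"
        by (auto simp: in_segment)
      have "a \<bullet> y = (1 - t) * (a \<bullet> p) + t * b"
        using t \<open>a \<bullet> x = b\<close> by (simp add: inner_right_distrib)
      also have "\<dots> < (1 - t) * b + t * b" using hp t by simp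
      finally have "a \<bullet> y < b" by (simp add: algebra_simps)
      moreover have "y \<in> K"
        using y p(1) that(1) K \<open>convex K\<close> closed_segment_subset[of p K x]
          segment_open_subset_closed by blast
      ultimately show "y \<in> F" using below K by blast
    qed
    then have "closure (open_segment p x) \<subseteq> F" using clF by (rule closure_minimal)
    then show ?thesis using \<open>p \<noteq> x\<close> by auto
  qed
  have hq: "a \<bullet> q > b"
    using le[of q] q K by force
  have ge: "x \<in> G" if "x \<in> K" "a \<bullet> x \<ge> b" for x
  proof (cases "a \<bullet> x > b")
    case True
    then show ?thesis using Fle K that by force
  next
    case False
    then have "x \<in> F" "a \<bullet> x = b" using le that by auto
    then show ?thesis using FGeq by blast
  qed
  show ?thesis
  proof
    show "F = K \<inter> {x. a \<bullet> x \<le> b}" using le Fle K by blast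
    show "G = K \<inter> {x. a \<bullet> x \<ge> b}" using ge below K by force
  qed (use p q hp hq K in auto)
qed

text \<open>
  Joining two points on opposite sides of the hyperplane and evaluating where the segment crosses
  it shows that the two affine functions have the same ratio at both ends; so the ratio is
  the same at all points off the hyperplane. This takes the place of a dimension count.
\<close>

lemma affine_functional_multiple:
  fixes a c :: "'a::real_inner"
  assumes "convex K"
    and vanish: "\<And>x. x \<in> K \<Longrightarrow> a \<bullet> x = b \<Longrightarrow> c \<bullet> x = d"
    and p: "p \<in> K" "a \<bullet> p < b" and q: "q \<in> K" "a \<bullet> q > b"
  obtains l where "\<And>x. x \<in> K \<Longrightarrow> c \<bullet> x - d = l * (a \<bullet> x - b)"
proof -
  have cross: "(c \<bullet> x - d) * (a \<bullet> y - b) = (c \<bullet> y - d) * (a \<bullet> x - b)"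
    if "x \<in> K" "y \<in> K" "a \<bullet> x < b" "a \<bullet> y > b" for x y
  proof -
    define s where "s = a \<bullet> y - a \<bullet> x"
    define t where "t = (b - a \<bullet> x) / s"
    have s: "s > 0" using that by (simp add: s_def)
    have t: "0 \<le> t" "t \<le> 1" using that s by (auto simp: t_def s_def field_simps)
    have "(1 - t) *\<^sub>R x + t *\<^sub>R y \<in> K" (is "?m \<in> K")
      using convexD[OF \<open>convex K\<close> that(1,2)] t by simp
    moreover have ts: "t * s = b - a \<bullet> x" using s by (simp add: t_def)
    then have "a \<bullet> ?m = b"
      by (simp add: inner_right_distrib s_def algebra_simps)
    ultimately have "c \<bullet> ?m = d" by (rule vanish)
    then have "s * ((1 - t) * (c \<bullet> x) + t * (c \<bullet> y)) = s * d"
      by (simp add: inner_right_distrib)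
    then have "(s - t * s) * (c \<bullet> x) + (t * s) * (c \<bullet> y) = s * d"
      by (simp add: algebra_simps)
    then show ?thesis unfolding ts by (simp add: s_def algebra_simps)
  qed
  define l where "l = (c \<bullet> p - d) / (a \<bullet> p - b)"
  have lp: "c \<bullet> p - d = l * (a \<bullet> p - b)" using p by (simp add: l_def)
  have above: "c \<bullet> x - d = l * (a \<bullet> x - b)" if "x \<in> K" "a \<bullet> x > b" for x
  proof -
    have "(a \<bullet> p - b) * (c \<bullet> x - d) = (a \<bullet> p - b) * (l * (a \<bullet> x - b))"
      using cross[OF p(1) that(1) p(2) that(2)] unfolding lp by (simp only: mult_ac)
    then show ?thesis using p(2) by (metis mult_cancel_left less_irrefl eq_iff_diff_eq_0)
  qed
  have "c \<bullet> x - d = l * (a \<bullet> x - b)" if "x \<in> K" for x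
  proof -
    consider "a \<bullet> x < b" | "a \<bullet> x = b" | "a \<bullet> x > b" by linarith
    then show ?thesis
    proof cases
      case 1
      have "(a \<bullet> q - b) * (c \<bullet> x - d) = (a \<bullet> q - b) * (l * (a \<bullet> x - b))"
        using cross[OF that q(1) 1 q(2)] unfolding above[OF q] by (simp only: mult_ac)
      then show ?thesis using q by simp
    qed (use vanish above that in auto)
  qed
  then show ?thesis by (rule that)
qed

section \<open>Bruhat order\<close>

lemma finite_inversions: "finite (inversions n w)"
  by (rule finite_subset[of _ "{1..n} \<times> {1..n}"]) (auto simp: inversions_def)

text \<open>
  Conjugating by the swap embeds the inversions after removing an adjacent descent into those
  before it, and the pair \<open>(i, i + 1)\<close> is missed.
\<close>

lemma perm_length_adjacent_swap:
  assumes "1 \<le> i" "Suc i \<le> n" "z (Suc i) < z i"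
  shows "perm_length n (z \<circ> Transposition.transpose i (Suc i)) < perm_length n z"
proof -
  define t where "t = Transposition.transpose i (Suc i)"
  have inj: "inj (map_prod t t)"
    by (simp add: t_def prod.inj_map)
  have sub: "map_prod t t ` inversions n (z \<circ> t) \<subseteq> inversions n z - {(i, Suc i)}"
  proof (rule image_subsetI)
    fix x assume "x \<in> inversions n (z \<circ> t)"
    then obtain p q where x: "x = (p, q)" and pq: "1 \<le> p" "p < q" "q \<le> n" "z (t p) > z (t q)"
      by (auto simp: inversions_def)
    have "\<not> (p = i \<and> q = Suc i)" using pq(4) assms(3) by (auto simp: t_def)
    then have "t p < t q" "1 \<le> t p" "t q \<le> n"
      using pq(1-3) assms(1,2) by (auto simp: t_def Transposition.transpose_def)
    moreover have "\<not> (t p = i \<and> t q = Suc i)"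
      using pq(2) by (auto simp: t_def Transposition.transpose_def split: if_splits)
    ultimately show "map_prod t t x \<in> inversions n z - {(i, Suc i)}"
      using pq x by (auto simp: inversions_def)
  qed
  have mem: "(i, Suc i) \<in> inversions n z" using assms by (auto simp: inversions_def)
  have "perm_length n (z \<circ> t) = card (map_prod t t ` inversions n (z \<circ> t))"
    unfolding perm_length_def using inj by (metis card_image inj_on_subset subset_UNIV)
  also have "\<dots> \<le> card (inversions n z - {(i, Suc i)})"
    by (rule card_mono[OF _ sub]) (simp add: finite_inversions)
  also have "\<dots> < perm_length n z"
    unfolding perm_length_def by (rule card_Diff1_less[OF finite_inversions mem])
  finally show ?thesis unfolding t_def .
qed

lemma transposition_permutes:
  assumes "z permutes {1..n}" "i \<in> {1..n}" "k \<in> {1..n}"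
  shows "z \<circ> Transposition.transpose i k permutes {1..n}"
  using assms by (meson permutes_compose permutes_swap_id)

lemma adjacent_swap_bruhat_le:
  assumes "z permutes {1..n}" "1 \<le> i" "Suc i \<le> n" "z (Suc i) < z i"
  shows "bruhat_le n (z \<circ> Transposition.transpose i (Suc i)) z"
proof -
  let ?y = "z \<circ> Transposition.transpose i (Suc i)"
  have "z = ?y \<circ> Transposition.transpose i (Suc i)"
    by (simp add: comp_assoc)
  then have "bruhat_step n ?y z"
    unfolding bruhat_step_def
    using perm_length_adjacent_swap[OF assms(2-4)] assms(2,3)
    by (intro conjI bexI[of _ i] bexI[of _ "Suc i"]) auto
  moreover have "?y permutes {1..n}" using assms by (intro transposition_permutes) auto
  ultimately show ?thesis using assms(1) by (auto simp: bruhat_le_def)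
qed

lemma bruhat_le_trans: "bruhat_le n x y \<Longrightarrow> bruhat_le n y z \<Longrightarrow> bruhat_le n x z"
  unfolding bruhat_le_def by auto

text \<open>
  Descents at adjacent positions can be removed until none is left, and the only permutation
  without such a descent is the identity.
\<close>

lemma id_bruhat_le:
  assumes "z permutes {1..n}"
  shows "bruhat_le n id z"
  using assms
proof (induction "perm_length n z" arbitrary: z rule: less_induct)
  case less
  show ?case
  proof (cases "\<exists>i. 1 \<le> i \<and> Suc i \<le> n \<and> z (Suc i) < z i")
    case True
    then obtain i where i: "1 \<le> i" "Suc i \<le> n" "z (Suc i) < z i" by blast
    let ?y = "z \<circ> Transposition.transpose i (Suc i)"
    have "?y permutes {1..n}" using less.prems i by (intro transposition_permutes) auto
    then have "bruhat_le n id ?y" using less.hyps perm_length_adjacent_swap[OF i] by blast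
    then show ?thesis using adjacent_swap_bruhat_le[OF less.prems i] bruhat_le_trans by blast
  next
    case False
    have inj: "inj z" using less.prems permutes_inj by blast
    have asc: "z i < z (Suc i)" if "1 \<le> i" "Suc i \<le> n" for i
      using False that inj by (metis inj_eq n_not_Suc_n nat_neq_iff)
    have range: "i \<in> {1..n} \<Longrightarrow> z i \<in> {1..n}" for i
      using permutes_in_image[OF less.prems] by blast
    have lower: "i \<le> n \<Longrightarrow> i \<le> z i" for i
    proof (induction i)
      case (Suc i)
      then show ?case using asc[of i] range[of "Suc i"] by (cases "i = 0") auto
    qed simp
    have "z i = i" for i
    proof (cases "i \<in> {1..n}")
      case True
      have "sum z {1..n} = \<Sum>{1..n}"
        using sum.permute[OF less.prems, of id] by simp
      then have "z i = i"
        using sum_mono_inv[of "\<lambda>i. i" "{1..n}" z i] lower True by auto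
      then show ?thesis .
    qed (use less.prems in \<open>simp add: permutes_not_in\<close>)
    then have "z = id" by auto
    then show ?thesis using less.prems by (auto simp: bruhat_le_def)
  qed
qed

lemma bruhat_le_id:
  assumes "bruhat_le n u id"
  shows "u = id"
proof -
  have "inversions n id = {}" by (auto simp: inversions_def)
  then have "perm_length n id = 0" by (simp add: perm_length_def)
  then have "\<not> bruhat_step n w id" for w by (simp add: bruhat_step_def)
  moreover have "(bruhat_step n)\<^sup>*\<^sup>* u id" using assms by (simp add: bruhat_le_def)
  ultimately show ?thesis by (metis rtranclp.cases)
qed


section \<open>Permutation points and block sums\<close>

definition block_vec :: "(nat \<Rightarrow> 'n) \<Rightarrow> nat set \<Rightarrow> real ^ 'n::finite" where
  "block_vec e B = (\<Sum>i\<in>B. axis (e i) 1)"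

lemma inner_perm_point:
  fixes a :: "real ^ 'n::finite"
  shows "a \<bullet> perm_point n e z = (\<Sum>i\<in>{1..n}. real (z i) * a $ e i)"
  by (simp add: perm_point_def inner_sum_right inner_axis mult_ac)

lemma inner_block_vec_perm_point:
  assumes "bij_betw e {1..n} (UNIV :: 'n::finite set)" and "B \<subseteq> {1..n}"
  shows "block_vec e B \<bullet> perm_point n e z = real (sum z B)"
proof -
  have "block_vec e B \<bullet> perm_point n e z = (\<Sum>i\<in>B. perm_point n e z $ e i)"
    by (simp add: block_vec_def inner_sum_left inner_axis')
  also have "\<dots> = (\<Sum>i\<in>B. real (z i))"
    using assms by (intro sum.cong) (auto simp: perm_point_nth)
  finally show ?thesis by simp
qed

lemma convex_hull_halfspace_le:
  assumes "\<And>x. x \<in> S \<Longrightarrow> a \<bullet> x \<le> b" and "x \<in> convex hull S"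
  shows "a \<bullet> x \<le> b"
  using hull_minimal[of S "{x. a \<bullet> x \<le> b}" convex] assms convex_halfspace_le by blast

lemma convex_hull_halfspace_ge:
  assumes "\<And>x. x \<in> S \<Longrightarrow> a \<bullet> x \<ge> b" and "x \<in> convex hull S"
  shows "a \<bullet> x \<ge> b"
  using hull_minimal[of S "{x. a \<bullet> x \<ge> b}" convex] assms convex_halfspace_ge by blast

lemma block_vec_inner_all:
  assumes "bij_betw e {1..n} (UNIV :: 'n::finite set)" and "x \<in> permutahedron n e"
  shows "block_vec e {1..n} \<bullet> x = real (\<Sum>{1..n})"
proof -
  have eq: "block_vec e {1..n} \<bullet> y = real (\<Sum>{1..n})"
    if "y \<in> perm_point n e ` {z. z permutes {1..n}}" for y :: "real ^ 'n"
  proof -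
    obtain z where z: "z permutes {1..n}" "y = perm_point n e z"
      using \<open>y \<in> _\<close> by blast
    then have "sum z {1..n} = \<Sum>{1..n}" using sum.permute[of z "{1..n}" id] by simp
    then show ?thesis using z(2) inner_block_vec_perm_point[OF assms(1) order_refl] by metis
  qed
  show ?thesis
    using convex_hull_halfspace_le[OF eq_refl[OF eq]] 
      convex_hull_halfspace_ge[OF eq_refl[OF eq[symmetric]]] assms(2)
    unfolding permutahedron_def by (meson order_antisym)
qed

lemma block_vec_inner_complement:
  assumes "bij_betw e {1..n} (UNIV :: 'n::finite set)" and "x \<in> permutahedron n e" "B \<subseteq> {1..n}"
  shows "block_vec e ({1..n} - B) \<bullet> x = real (\<Sum>{1..n}) - block_vec e B \<bullet> x"
proof -
  have "block_vec e {1..n} = block_vec e ({1..n} - B) + block_vec e B"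
    unfolding block_vec_def using sum.subset_diff[OF assms(3)] by blast
  then show ?thesis
    using block_vec_inner_all[OF assms(1,2)] by (simp add: inner_left_distrib)
qed

text \<open>
  All permutation points have the same norm, so by strict convexity of the ball each of them is
  strictly separated from all others by the functional given by the point itself.
\<close>

lemma perm_point_in_hull_iff:
  assumes e: "bij_betw e {1..n} (UNIV :: 'n::finite set)"
    and z: "z permutes {1..n}" and I: "I \<subseteq> {z. z permutes {1..n}}"
  shows "perm_point n e z \<in> convex hull (perm_point n e ` I) \<longleftrightarrow> z \<in> I"
proof
  assume hull: "perm_point n e z \<in> convex hull (perm_point n e ` I)"
  show "z \<in> I"
  proof (rule ccontr)
    assume "z \<notin> I"
    let ?a = "perm_point n e z"
    have norm: "perm_point n e w \<bullet> perm_point n e w = (\<Sum>i\<in>{1..n}. (real i)\<^sup>2)"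
      if "w permutes {1..n}" for w
      using sum.permute[OF that, of "\<lambda>i. (real i)\<^sup>2"] 
      by (simp add: inner_perm_point perm_point_nth[OF e] power2_eq_square)
    have "?a \<bullet> perm_point n e w < ?a \<bullet> ?a" if "w \<in> I" for w
    proof -
      have w: "w permutes {1..n}" "w \<noteq> z" using that I \<open>z \<notin> I\<close> by auto
      then obtain i where "w i \<noteq> z i" by blast
      then have "i \<in> {1..n}" using w(1) z by (metis permutes_not_in)
      then have "?a \<noteq> perm_point n e w"
        using \<open>w i \<noteq> z i\<close> perm_point_nth[OF e, of i] by (metis of_nat_eq_iff)
      then have "0 < (?a - perm_point n e w) \<bullet> (?a - perm_point n e w)" by simp
      also have "\<dots> = 2 * (?a \<bullet> ?a) - 2 * (?a \<bullet> perm_point n e w)"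
        using norm[OF z] norm[OF w(1)] by (simp add: inner_diff inner_commute algebra_simps)
      finally show ?thesis by simp
    qed
    then have "convex hull (perm_point n e ` I) \<subseteq> {x. ?a \<bullet> x < ?a \<bullet> ?a}"
      by (intro hull_minimal convex_halfspace_lt) auto
    then show False using hull by blast
  qed
qed (simp add: hull_inc)

lemma sum_swap_positions:
  fixes z :: "nat \<Rightarrow> nat" and c :: "nat \<Rightarrow> real"
  assumes "finite A" "i \<in> A" "k \<in> A" "i \<noteq> k"
  shows "(\<Sum>m\<in>A. real ((z \<circ> Transposition.transpose i k) m) * c m) =
    (\<Sum>m\<in>A. real (z m) * c m) + (real (z i) - real (z k)) * (c k - c i)"
proof -
  define R where "R = A - {i, k}"
  have A: "A = insert i (insert k R)" "i \<notin> insert k R" "k \<notin> R" "finite R"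
    using assms by (auto simp: R_def)
  have "(\<Sum>m\<in>R. real ((z \<circ> Transposition.transpose i k) m) * c m) = (\<Sum>m\<in>R. real (z m) * c m)"
    by (rule sum.cong) (auto simp: R_def Transposition.transpose_def)
  then show ?thesis using A by (simp add: algebra_simps)
qed

lemma inner_perm_point_swap:
  fixes a :: "real ^ 'n::finite"
  assumes "i \<in> {1..n}" "k \<in> {1..n}" "i \<noteq> k"
  shows "a \<bullet> perm_point n e (z \<circ> Transposition.transpose i k) =
    a \<bullet> perm_point n e z + (real (z i) - real (z k)) * (a $ e k - a $ e i)"
  unfolding inner_perm_point using assms by (intro sum_swap_positions) auto

section \<open>The common facet fixes the set of values on a block of positions\<close>

text \<open>
  The normal vector can be replaced by the indicator of a block of positions because Bruhat steps
  move in the directions of differences of two unit vectors. Integrality of \<open>\<beta>\<close> comes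
  from \<open>u\<close>, which lies on the hyperplane.
\<close>

lemma BIP_halves_by_block:
  fixes a :: "real ^ 'n::finite"
  assumes e: "bij_betw e {1..n} (UNIV :: 'n set)"
    and I: "I = bruhat_interval n id v" and J: "J = bruhat_interval n u w"
    and P: "P = permutahedron n e"
    and F: "F = convex hull (perm_point n e ` I)" and G: "G = convex hull (perm_point n e ` J)"
    and face: "F \<inter> G face_of F"
    and Fa: "F = P \<inter> {x. a \<bullet> x \<le> b}" and Ga: "G = P \<inter> {x. a \<bullet> x \<ge> b}"
    and p: "p \<in> P" "a \<bullet> p < b" and q: "q \<in> P" "a \<bullet> q > b"
  obtains B \<beta> where "B \<subseteq> {1..n}" "B \<noteq> {}" "B \<noteq> {1..n}"
    "F = P \<inter> {x. block_vec e B \<bullet> x \<le> real \<beta>}" "G = P \<inter> {x. block_vec e B \<bullet> x \<ge> real \<beta>}"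
    "sum u B = \<beta>" "u \<in> I \<inter> J" "\<And>z. z \<in> I \<inter> J \<Longrightarrow> z ` B = u ` B"
    "\<exists>z. z permutes {1..n} \<and> sum z B < \<beta>" "\<exists>z. z permutes {1..n} \<and> sum z B > \<beta>"
proof -
  have IS: "I \<subseteq> {z. z permutes {1..n}}" and JS: "J \<subseteq> {z. z permutes {1..n}}"
    unfolding I J bruhat_interval_def bruhat_le_def by auto
  have "finite {z. z permutes {1..n}}" by (simp add: finite_permutations)
  then have finI: "finite I" using IS finite_subset by blast
  have convP: "convex P" by (simp add: P permutahedron_def)
  have FG: "F \<inter> G = P \<inter> {x. a \<bullet> x = b}" unfolding Fa Ga by auto
  \<comment> \<open>A face of \<open>F\<close> is spanned by generators of \<open>F\<close>; those lying in \<open>G\<close> come from \<open>J\<close>.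
    So the common cell is the hull of the permutations common to both intervals.\<close>
  obtain S' where S': "S' \<subseteq> perm_point n e ` I" "F \<inter> G = convex hull S'"
    using face_of_convex_hull_subset[of "perm_point n e ` I" "F \<inter> G"] face finI 
    unfolding F by (metis finite_imageI finite_imp_compact)
  have S'sub: "S' \<subseteq> perm_point n e ` (I \<inter> J)"
  proof
    fix x assume "x \<in> S'"
    then obtain z where z: "z \<in> I" "x = perm_point n e z" using S'(1) by blast
    have "x \<in> F \<inter> G" unfolding S'(2) using \<open>x \<in> S'\<close> by (rule hull_inc)
    then have "x \<in> G" by simp
    moreover have "z permutes {1..n}" using z(1) IS by blast
    ultimately have "z \<in> J" using perm_point_in_hull_iff[OF e _ JS] unfolding G z(2) by blast
    then show "x \<in> perm_point n e ` (I \<inter> J)" using z by blast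
  qed
  have H_hull: "P \<inter> {x. a \<bullet> x = b} \<subseteq> convex hull (perm_point n e ` (I \<inter> J))"
    using S'(2) FG hull_mono[OF S'sub] by auto
  have IJ_H: "a \<bullet> perm_point n e z = b" if "z \<in> I \<inter> J" for z
  proof -
    have "perm_point n e z \<in> F" "perm_point n e z \<in> G"
      unfolding F G using that by (auto intro: hull_inc)
    then show ?thesis using FG by blast
  qed
  have "P \<inter> {x. a \<bullet> x = b} \<noteq> {}"
  proof -
    have "connected P" using convP convex_connected by blast
    then show ?thesis using p q connected_ivt_hyperplane[of P p q a b] by force
  qed
  then have "I \<inter> J \<noteq> {}" using H_hull by auto
  then obtain z1 where z1: "z1 \<in> I \<inter> J" by blast
  have idle: "bruhat_le n id y" if "bruhat_le n y z" for y z
    using that id_bruhat_le bruhat_le_def by blast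
  have down: "y \<in> I \<inter> J" if "z \<in> I \<inter> J" "bruhat_le n u y" "bruhat_le n y z" for y z
    using that bruhat_le_trans idle unfolding I J bruhat_interval_def by blast
  have u_perm: "u permutes {1..n}" using z1 by (auto simp: J bruhat_interval_def bruhat_le_def)
  then have "bruhat_le n u u" by (simp add: bruhat_le_def)
  then have u: "u \<in> I \<inter> J" using down[OF z1] z1 by (auto simp: J bruhat_interval_def)
  \<comment> \<open>A Bruhat step between common permutations stays on the hyperplane, so it exchanges two
    positions with equal coefficients and preserves every union of level sets of \<open>a\<close>.\<close>
  have image_const: "z ` B = u ` B"
    if B: "B \<subseteq> {1..n}" "\<And>i k. i \<in> {1..n} \<Longrightarrow> k \<in> {1..n} \<Longrightarrow> a $ e i = a $ e k \<Longrightarrow> i \<in> B \<longleftrightarrow> k \<in> B"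
      and z: "z \<in> I \<inter> J" for B z
  proof -
    have "(bruhat_step n)\<^sup>*\<^sup>* u z" using z by (simp add: J bruhat_interval_def bruhat_le_def)
    then show ?thesis using z
    proof (induction rule: rtranclp_induct)
      case (step y z)
      obtain i k where ik: "i \<in> {1..n}" "k \<in> {1..n}" "i \<noteq> k" 
        and z: "z = y \<circ> Transposition.transpose i k"
        using step.hyps(2) unfolding bruhat_step_def by blast
      have zp: "z permutes {1..n}" using step.prems IS by blast
      have "y = z \<circ> Transposition.transpose i k" using z by (simp add: comp_assoc)
      then have yp: "y permutes {1..n}" using transposition_permutes[OF zp ik(1,2)] by simp
      have "bruhat_le n u y" "bruhat_le n y z"
        using step.hyps u_perm yp zp by (auto simp: bruhat_le_def)
      then have y: "y \<in> I \<inter> J" using down[OF step.prems] by blast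
      have "(real (y i) - real (y k)) * (a $ e k - a $ e i) = 0"
        using inner_perm_point_swap[OF ik, of a e y] IJ_H[OF y] IJ_H[OF step.prems]
        unfolding z[symmetric] by simp
      moreover have "y i \<noteq> y k" using ik(3) yp permutes_inj by (metis injD)
      ultimately have "i \<in> B \<longleftrightarrow> k \<in> B" using B(2)[OF ik(1,2)] by simp
      then have "Transposition.transpose i k ` B = B" by (auto simp: transpose_image_eq)
      then have "z ` B = y ` B" unfolding z by (metis image_comp)
      then show ?case using step.IH[OF y] by simp
    qed simp
  qed
  \<comment> \<open>Otherwise \<open>a \<bullet> x\<close> would be a multiple of the sum of all coordinates, hence constant on \<open>P\<close>.\<close>
  have "\<exists>i\<in>{1..n}. \<exists>k\<in>{1..n}. a $ e i \<noteq> a $ e k"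
  proof (rule ccontr)
    assume neg: "\<not> ?thesis"
    have "\<exists>c. \<forall>i\<in>{1..n}. a $ e i = c" using neg by metis
    then obtain c where "\<forall>i\<in>{1..n}. a $ e i = c" by blast
    moreover have surj: "\<exists>i\<in>{1..n}. e i = j" for j
      using bij_betw_imp_surj_on[OF e] by (metis UNIV_I imageE)
    ultimately have "a $ j = c" for j by metis
    moreover have "(block_vec e {1..n} :: real ^ 'n) $ j = 1" for j
    proof -
      obtain i where i: "i \<in> {1..n}" "e i = j" using surj by blast
      have "(block_vec e {1..n} :: real ^ 'n) $ j = (\<Sum>k\<in>{1..n}. if k = i then 1 else 0)"
        unfolding block_vec_def sum_component
      proof (rule sum.cong)
        fix k assume "k \<in> {1..n}"
        then have "j = e k \<longleftrightarrow> k = i"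
          using inj_onD[OF bij_betw_imp_inj_on[OF e]] i by blast
        then show "(axis (e k) 1 :: real ^ 'n) $ j = (if k = i then 1 else 0)"
          by (simp add: axis_def)
      qed simp
      then show ?thesis using i by simp
    qed
    ultimately have "a = c *\<^sub>R block_vec e {1..n}" by (simp add: vec_eq_iff)
    then have "a \<bullet> p = a \<bullet> q"
      using block_vec_inner_all[OF e, of p] block_vec_inner_all[OF e, of q] p q P by simp
    then show False using p q by simp
  qed
  then obtain i0 k0 where i0: "i0 \<in> {1..n}" "k0 \<in> {1..n}" "a $ e i0 \<noteq> a $ e k0" by blast
  define C where "C = {i \<in> {1..n}. a $ e i = a $ e i0}"
  have C: "C \<subseteq> {1..n}" "i0 \<in> C" "k0 \<notin> C" using i0 by (auto simp: C_def)
  have C_lev: "i \<in> C \<longleftrightarrow> k \<in> C" if "i \<in> {1..n}" "k \<in> {1..n}" "a $ e i = a $ e k" for i k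
    using that by (auto simp: C_def)
  have sum_image: "sum z B = \<Sum>(z ` B)" if "z permutes {1..n}" for z and B :: "nat set"
    using that by (simp add: sum.reindex[OF permutes_inj_on])
  have const: "block_vec e C \<bullet> x = real (sum u C)" if "x \<in> P" "a \<bullet> x = b" for x
  proof -
    have eq: "block_vec e C \<bullet> y = real (sum u C)" if "y \<in> perm_point n e ` (I \<inter> J)" for y
    proof -
      obtain z where z: "z \<in> I \<inter> J" "y = perm_point n e z" using \<open>y \<in> _\<close> by blast
      have "z permutes {1..n}" using z(1) IS by blast
      then have "sum z C = sum u C"
        using sum_image[of _ C] u_perm image_const[OF C(1) C_lev z(1)] by metis
      then show ?thesis using z(2) inner_block_vec_perm_point[OF e C(1)] by metis
    qed
    have "x \<in> convex hull (perm_point n e ` (I \<inter> J))" using that H_hull by blast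
    then show ?thesis
      using convex_hull_halfspace_le[OF eq_refl[OF eq]] 
        convex_hull_halfspace_ge[OF eq_refl[OF eq[symmetric]]] by (meson order_antisym)
  qed
  obtain l where l: "\<And>x. x \<in> P \<Longrightarrow> block_vec e C \<bullet> x - real (sum u C) = l * (a \<bullet> x - b)"
    using affine_functional_multiple[OF convP const p q] by metis
  have perm_P: "perm_point n e z \<in> P" if "z permutes {1..n}" for z
    using that unfolding P permutahedron_def by (simp add: hull_inc)
  \<comment> \<open>For \<open>l = 0\<close> the sum over \<open>C\<close> would be constant on all of \<open>P\<close>, but exchanging the values at a
    position in \<open>C\<close> and one outside changes it.\<close>
  have "l \<noteq> 0"
  proof
    assume "l = 0"
    let ?z = "u \<circ> Transposition.transpose i0 k0"
    have "?z permutes {1..n}" using transposition_permutes[OF u_perm] i0 by blast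
    then have "block_vec e C \<bullet> perm_point n e ?z = block_vec e C \<bullet> perm_point n e u"
      using l[OF perm_P] u_perm \<open>l = 0\<close> by (metis mult_zero_left eq_iff_diff_eq_0)
    then have "(\<Sum>m\<in>C. ?z m) = sum u C"
      unfolding inner_block_vec_perm_point[OF e C(1)] by linarith
    moreover have "(\<Sum>m\<in>C - {i0}. ?z m) = sum u (C - {i0})"
      using C(3) by (intro sum.cong) (auto simp: Transposition.transpose_def)
    moreover have "finite C" using C(1) finite_subset by blast
    ultimately have "?z i0 = u i0" using C(2) by (simp add: sum.remove)
    then have "u k0 = u i0" by simp
    then show False using u_perm i0(3) permutes_inj by (metis injD)
  qed
  \<comment> \<open>The coordinates have a constant sum, so passing to the complement reverses the sides when
    \<open>l\<close> is negative.\<close>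
  define B where "B = (if l > 0 then C else {1..n} - C)"
  define m where "m = \<bar>l\<bar>"
  have B: "B \<subseteq> {1..n}" "B \<noteq> {}" "B \<noteq> {1..n}" using C i0 by (auto simp: B_def)
  have "block_vec e B \<bullet> x - real (sum u B) = m * (a \<bullet> x - b)" if "x \<in> P" for x
  proof (cases "l > 0")
    case False
    have "sum u C + sum u ({1..n} - C) = sum u {1..n}"
      using sum.subset_diff[OF C(1), of u] by simp
    also have "\<dots> = \<Sum>{1..n}" using sum.permute[OF u_perm, of id] by simp
    finally have "real (sum u C) + real (sum u ({1..n} - C)) = real (\<Sum>{1..n})"
      by (metis of_nat_add)
    then have "block_vec e ({1..n} - C) \<bullet> x - real (sum u ({1..n} - C)) = - (l * (a \<bullet> x - b))"
      using l[OF that] block_vec_inner_complement[OF e _ C(1), of x] that unfolding P by linarith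
    then show ?thesis using False by (simp add: B_def m_def)
  qed (use l[OF that] in \<open>simp add: B_def m_def\<close>)
  moreover have "m > 0" using \<open>l \<noteq> 0\<close> by (simp add: m_def)
  ultimately have sgn: "block_vec e B \<bullet> x \<le> real (sum u B) \<longleftrightarrow> a \<bullet> x \<le> b"
    "block_vec e B \<bullet> x \<ge> real (sum u B) \<longleftrightarrow> a \<bullet> x \<ge> b" if "x \<in> P" for x
    using that by (smt (verit) mult_le_0_iff zero_le_mult_iff)+
  have B_lev: "i \<in> B \<longleftrightarrow> k \<in> B" if "i \<in> {1..n}" "k \<in> {1..n}" "a $ e i = a $ e k" for i k
    using that by (auto simp: B_def C_def)
  show ?thesis
  proof
    show "F = P \<inter> {x. block_vec e B \<bullet> x \<le> real (sum u B)}"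
      "G = P \<inter> {x. block_vec e B \<bullet> x \<ge> real (sum u B)}"
      using sgn unfolding Fa Ga by auto
    show "z ` B = u ` B" if "z \<in> I \<inter> J" for z
      using image_const[OF B(1) B_lev that] .
    show "\<exists>z. z permutes {1..n} \<and> sum z B < sum u B"
    proof (rule ccontr)
      assume "\<not> ?thesis"
      then have "block_vec e B \<bullet> y \<ge> real (sum u B)" 
        if "y \<in> perm_point n e ` {z. z permutes {1..n}}" for y
        using that by (force simp: inner_block_vec_perm_point[OF e B(1)] not_less simp del: of_nat_sum)
      then have "block_vec e B \<bullet> p \<ge> real (sum u B)"
        using p(1) unfolding P permutahedron_def by (rule convex_hull_halfspace_ge)
      then show False using sgn p by force
    qed
    show "\<exists>z. z permutes {1..n} \<and> sum z B > sum u B"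
    proof (rule ccontr)
      assume "\<not> ?thesis"
      then have "block_vec e B \<bullet> y \<le> real (sum u B)" 
        if "y \<in> perm_point n e ` {z. z permutes {1..n}}" for y
        using that by (force simp: inner_block_vec_perm_point[OF e B(1)] not_less simp del: of_nat_sum)
      then have "block_vec e B \<bullet> q \<le> real (sum u B)"
        using q(1) unfolding P permutahedron_def by (rule convex_hull_halfspace_le)
      then show False using sgn q by force
    qed
  qed (use B u in auto)
qed

section \<open>Subsets determined by their size and sum\<close>

text \<open>
  Were every element of \<open>T - S\<close> at most every element of \<open>S - T\<close>, matching these two sets of equal
  size would bound the sum of \<open>T\<close> by that of \<open>S\<close>. The lemma produces witnesses that a subset
  does not consist of the largest, or of the smallest, elements.
\<close>

lemma sum_less_imp_exchange:
  fixes S T :: "nat set"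
  assumes "finite S" "finite T" "card S = card T" "\<Sum>S < \<Sum>T"
  shows "\<exists>s\<in>S - T. \<exists>t\<in>T - S. s < t"
proof (rule ccontr)
  assume "\<not> ?thesis"
  then have le: "t \<le> s" if "s \<in> S - T" "t \<in> T - S" for s t
    using that by (meson not_le)
  have "card (T - S) = card (S - T)"
    using assms by (simp add: card_Diff_subset_Int Int_commute)
  then obtain f where f: "bij_betw f (T - S) (S - T)"
    using assms(1,2) by (meson finite_Diff finite_same_card_bij)
  have "\<Sum>(T - S) \<le> (\<Sum>t\<in>T - S. f t)"
    using le f by (intro sum_mono) (auto dest: bij_betwE)
  also have "\<dots> = \<Sum>(S - T)" using sum.reindex_bij_betw[OF f, of id] by simp
  finally have "\<Sum>(T - S) \<le> \<Sum>(S - T)" .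
  moreover have "\<Sum>S = \<Sum>(S \<inter> T) + \<Sum>(S - T)" "\<Sum>T = \<Sum>(S \<inter> T) + \<Sum>(T - S)"
    using sum.Int_Diff[OF assms(1), of id T] sum.Int_Diff[OF assms(2), of id S]
    by (simp_all add: Int_commute)
  ultimately show False using assms(4) by linarith
qed

lemma permutes_with_image:
  assumes "finite A" "B \<subseteq> A" "T \<subseteq> A" "card B = card T"
  obtains z where "z permutes A" "z ` B = T"
proof -
  have fin: "finite B" "finite T"
    using finite_subset[OF assms(2,1)] finite_subset[OF assms(3,1)] .
  obtain f where f: "bij_betw f B T" using finite_same_card_bij[OF fin assms(4)] by blast
  have "card (A - B) = card (A - T)" using assms fin by (simp add: card_Diff_subset)
  then obtain g where g: "bij_betw g (A - B) (A - T)"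
    using finite_same_card_bij[OF finite_Diff[OF assms(1)] finite_Diff[OF assms(1)]] by blast
  define z where "z i = (if i \<in> B then f i else if i \<in> A then g i else i)" for i
  have zB: "bij_betw z B T" using f by (rule bij_betw_cong[THEN iffD1, rotated]) (simp add: z_def)
  have zA: "bij_betw z (A - B) (A - T)"
    using g by (rule bij_betw_cong[THEN iffD1, rotated]) (simp add: z_def)
  have "bij_betw z (B \<union> (A - B)) (T \<union> (A - T))"
    using zB zA by (rule bij_betw_combine) auto
  then have "bij_betw z A A" using assms(2,3) by (simp add: Un_absorb1)
  then have "z permutes A"
    by (rule bij_imp_permutes) (use assms(2) in \<open>auto simp: z_def\<close>)
  moreover have "z ` B = T" using zB by (simp add: bij_betw_imp_surj_on)
  ultimately show ?thesis by (rule that)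
qed

lemma downward_closed_eq_initial_segment:
  fixes B :: "nat set"
  assumes "B \<subseteq> {1..n}" "B \<noteq> {}" and down: "\<And>i. 1 \<le> i \<Longrightarrow> Suc i \<in> B \<Longrightarrow> i \<in> B"
  shows "B = {1..card B}"
proof -
  have fin: "finite B" using assms(1) finite_subset by blast
  define m where "m = Max B"
  have m: "m \<in> B" using fin assms(2) by (simp add: m_def)
  have "i \<in> B" if "1 \<le> i" "i \<le> m" for i
    using that(2,1) m by (induction i rule: inc_induct) (auto intro: down)
  then have "B = {1..m}" using assms(1) fin by (auto simp: m_def)
  then show ?thesis by simp
qed

text \<open>
  Lowering one element by a unit and raising another by a unit keeps size and sum. If \<open>S\<close> is alone
  with its sum, a movable pair must be degenerate: it is one element that can move both ways,
  or two elements with a gap of one number that both would occupy.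
\<close>

lemma unique_shift:
  fixes S :: "nat set"
  assumes S: "S \<subseteq> {1..n}"
    and uniq: "\<forall>T\<subseteq>{1..n}. card T = card S \<longrightarrow> \<Sum>T = \<Sum>S \<longrightarrow> T = S"
    and x: "Suc x \<in> S" "x \<notin> S" "1 \<le> x" and y: "y \<in> S" "Suc y \<notin> S" "y < n"
  shows "y = Suc x \<or> x = Suc y"
proof (rule ccontr)
  assume neg: "\<not> ?thesis"
  define R where "R = S - {Suc x, y}"
  define T where "T = insert x (insert (Suc y) R)"
  have fin: "finite R" using S finite_subset by (auto simp: R_def)
  have "S = insert (Suc x) (insert y R)" using x y by (auto simp: R_def)
  moreover have "Suc x \<notin> insert y R" "y \<notin> R" using neg by (auto simp: R_def)
  moreover have "x \<notin> insert (Suc y) R" "Suc y \<notin> R" using neg x y by (auto simp: R_def)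
  ultimately have "card T = card S" "\<Sum>T = \<Sum>S" using fin by (auto simp: T_def)
  moreover have "T \<subseteq> {1..n}" using S x y by (auto simp: T_def R_def)
  ultimately have "T = S" using uniq by blast
  then show False using x by (auto simp: T_def)
qed

text \<open>
  Let \<open>g\<close> and \<open>h\<close> be the least and the greatest number missing from \<open>S\<close>, \<open>x\<close> the first element of
  \<open>S\<close> above \<open>g\<close> and \<open>y\<close> the last one below \<open>h\<close>. Then \<open>x\<close> can be lowered and \<open>y\<close> can be raised, and so
  can \<open>h + 1\<close> and \<open>g - 1\<close>, respectively, if they belong to \<open>S\<close>. Applying the previous lemma to these
  pairs leaves only the two stated sets and sets of size 1 or \<open>n - 1\<close>.
\<close>

lemma unique_subset_of_sum:
  fixes S :: "nat set"
  assumes S: "S \<subseteq> {1..n}"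
    and uniq: "\<forall>T\<subseteq>{1..n}. card T = card S \<longrightarrow> \<Sum>T = \<Sum>S \<longrightarrow> T = S"
    and card: "2 \<le> card S" "card S \<le> n - 2"
    and up: "s \<in> S" "t \<notin> S" "t \<in> {1..n}" "s < t"
    and dn: "s' \<in> S" "t' \<notin> S" "t' \<in> {1..n}" "t' < s'"
  shows "S = {1..card S - 1} \<union> {card S + 1} \<or> S = {n - card S} \<union> {n - card S + 2..n}"
proof -
  have fin: "finite S" using S finite_subset by blast
  define g where "g = Min ({1..n} - S)"
  define h where "h = Max ({1..n} - S)"
  have ne: "{1..n} - S \<noteq> {}" using up by blast
  have gM: "g \<in> {1..n} - S" unfolding g_def using ne by (intro Min_in) auto
  have g_least: "i \<in> S" if "1 \<le> i" "i < g" for i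
  proof (rule ccontr)
    assume "i \<notin> S"
    then have "g \<le> i" unfolding g_def using that gM by (intro Min_le) auto
    then show False using that by simp
  qed
  have hM: "h \<in> {1..n} - S" unfolding h_def using ne by (intro Max_in) auto
  have h_greatest: "i \<in> S" if "h < i" "i \<le> n" for i
  proof (rule ccontr)
    assume "i \<notin> S"
    then have "i \<le> h" unfolding h_def using that by (intro Max_ge) auto
    then show False using that by simp
  qed
  have g: "1 \<le> g" "g \<le> n" "g \<notin> S" and h: "1 \<le> h" "h \<le> n" "h \<notin> S" using gM hM by auto
  have "g \<le> t'" using g_least[of t'] dn by (meson atLeastAtMost_iff not_le)
  then have ne: "s' \<in> {i \<in> S. g < i}" using dn by simp
  have "t \<le> h" using h_greatest[of t] up by (meson atLeastAtMost_iff not_le)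
  then have ne': "s \<in> {i \<in> S. i < h}" using up by simp
  define x where "x = Min {i \<in> S. g < i}"
  define y where "y = Max {i \<in> S. i < h}"
  have "x \<in> {i \<in> S. g < i}" unfolding x_def using ne fin by (intro Min_in) auto
  then have x: "x \<in> S" "g < x" by auto
  have x_least: "i \<notin> S" if "g < i" "i < x" for i
  proof
    assume "i \<in> S"
    then have "x \<le> i" unfolding x_def using that fin by (intro Min_le) auto
    then show False using that by simp
  qed
  have "y \<in> {i \<in> S. i < h}" unfolding y_def using ne' fin by (intro Max_in) auto
  then have y: "y \<in> S" "y < h" by auto
  have y_greatest: "i \<notin> S" if "y < i" "i < h" for i
  proof
    assume "i \<in> S"
    then have "i \<le> y" unfolding y_def using that fin by (intro Max_ge) auto
    then show False using that by simp
  qed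
  have shift: "b = a \<or> a = Suc (Suc b)"
    if "a \<in> S" "a - 1 \<notin> S" "2 \<le> a" "b \<in> S" "Suc b \<notin> S" "b < n" for a b
  proof -
    have "Suc (a - 1) = a" using that by simp
    then show ?thesis using unique_shift[OF S uniq, of "a - 1" b] that by fastforce
  qed
  have xd: "x - 1 \<notin> S" "2 \<le> x" using g x x_least[of "x - 1"] by (cases "x - 1 = g", auto)
  have yu: "Suc y \<notin> S" "y < n" using h y y_greatest[of "Suc y"] by (cases "Suc y = h", auto)
  have g_lo: "a = g - 1 + 2" if "1 < g" "a \<in> S" "a - 1 \<notin> S" "2 \<le> a" "g < a" for a
  proof -
    have "1 \<le> g - 1" "g - 1 < g" "Suc (g - 1) = g" "g - 1 < n" using that(1) g(2) by simp_all
    then show ?thesis using shift[OF that(2-4), of "g - 1"] g_least[of "g - 1"] g(3) that(1,5)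
      by auto
  qed
  have h_hi: "h + 1 = b + 2" if "h < n" "b \<in> S" "Suc b \<notin> S" "b < h" for b
  proof -
    have "h + 1 \<in> S" "h + 1 - 1 \<notin> S" "2 \<le> h + 1" "b < n"
      using h_greatest[of "h + 1"] that h by simp_all
    then show ?thesis using shift[of "h + 1" b] that by auto
  qed
  consider "y = x" | "x = Suc (Suc y)" using shift[OF x(1) xd y(1) yu] by blast
  then show ?thesis
  proof cases
    case 1
    have Seq: "S = {1..<g} \<union> {x} \<union> {h<..n}"
    proof (intro equalityI subsetI)
      fix i assume i: "i \<in> S"
      then have "1 \<le> i" "i \<le> n" "i \<noteq> g" "i \<noteq> h" using S g h by auto
      moreover have "\<not> (g < i \<and> i < x)" "\<not> (x < i \<and> i < h)"
        using x_least[of i] y_greatest[of i] i 1 by auto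
      ultimately show "i \<in> {1..<g} \<union> {x} \<union> {h<..n}" by auto
    next
      fix i assume "i \<in> {1..<g} \<union> {x} \<union> {h<..n}"
      then show "i \<in> S" using g_least h_greatest x by auto
    qed
    consider "g = 1" "h = n" | "1 < g" "h = n" | "g = 1" "h < n" | "1 < g" "h < n"
      using g(1) h(2) by linarith
    then show ?thesis
    proof cases
      case 1
      then have "S = {x}" using Seq by auto
      then show ?thesis using card(1) by simp
    next
      case 2
      have "x = g + 1" using g_lo[OF 2(1) x(1) xd x(2)] 2 by simp
      then have Seq': "S = insert (g + 1) {1..<g}" using Seq 2 by auto
      then have "card S = g" using 2 by simp
      then show ?thesis using Seq' g(1) by auto
    next
      case 3
      have "h = x + 1" using h_hi[OF 3(2) y(1) yu(1) y(2)] \<open>y = x\<close> by simp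
      then have Seq': "S = insert x {x + 1<..n}" using Seq 3 by auto
      then have "card S = n - x" using yu(2) \<open>y = x\<close> by simp
      then have "n - card S = x" using yu(2) \<open>y = x\<close> by simp
      then show ?thesis using Seq' by auto
    next
      case 4
      have "x = g + 1" "h = x + 1"
        using g_lo[OF 4(1) x(1) xd x(2)] h_hi[OF 4(2) y(1) yu(1) y(2)] 4 \<open>y = x\<close> by simp_all
      moreover have "h + 1 = g - 1 + 2"
        using g_lo[OF 4(1), of "h + 1"] h_greatest[of "h + 1"] h 4 x y \<open>y = x\<close> by simp
      ultimately show ?thesis using 4 by simp
    qed
  next
    case 2
    have "\<not> Suc y < g" "\<not> g < Suc y" 
      using g_least[of "Suc y"] yu x_least[of y] y g 2 by (auto simp: less_Suc_eq)
    then have "g = Suc y" by simp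
    moreover have "\<not> h < Suc y" "\<not> Suc y < h"
      using y y_greatest[of x] x h 2 by (auto simp: Suc_lessI) (metis Suc_lessI lessI less_SucI)
    then have "h = Suc y" by simp
    ultimately have "{1..n} - {Suc y} \<subseteq> S"
      using g_least h_greatest by (metis DiffE atLeastAtMost_iff insertI1 nat_neq_iff subsetI)
    then have "card ({1..n} - {Suc y}) \<le> card S" using fin by (rule card_mono[rotated])
    then have "n - 1 \<le> card S" using yu(2) by simp
    then show ?thesis using card by linarith
  qed
qed

section \<open>Identifying the hyperplane\<close>

text \<open>
  Suppose \<open>i + 1\<close> is in \<open>B\<close> and \<open>i\<close> is not. Permuting positions inside and outside \<open>B\<close> separately
  leaves the block sum unchanged and moves the small value \<open>s\<close> to \<open>i + 1\<close> and the large value \<open>t\<close> to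
  \<open>i\<close>. Removing this descent goes down in Bruhat order but raises the block sum above \<open>\<beta>\<close>.
\<close>

lemma BIP_halves_block_initial:
  fixes B :: "nat set"
  assumes B: "B \<subseteq> {1..n}" "B \<noteq> {}"
    and lower: "\<And>y z. y permutes {1..n} \<Longrightarrow> sum z B \<le> \<beta> \<Longrightarrow> bruhat_le n y z \<Longrightarrow> sum y B \<le> \<beta>"
    and u: "u permutes {1..n}" "sum u B = \<beta>"
    and up: "s \<in> u ` B" "t \<in> {1..n} - u ` B" "s < t"
  shows "B = {1..card B}"
proof (rule downward_closed_eq_initial_segment[OF B])
  fix i assume i: "1 \<le> i" "Suc i \<in> B"
  show "i \<in> B"
  proof (rule ccontr)
    assume iB: "i \<notin> B"
    have iN: "i \<in> {1..n}" "Suc i \<in> {1..n}" using i B(1) by auto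
    have inj: "inj u" using u(1) permutes_inj by blast
    obtain c where c: "c \<in> B" "u c = s" using up(1) by blast
    have "t \<in> u ` {1..n}" using up(2) permutes_image[OF u(1)] by blast
    then obtain d where d: "d \<in> {1..n}" "d \<notin> B" "u d = t" using up(2) by blast
    define z where "z = u \<circ> Transposition.transpose c (Suc i) \<circ> Transposition.transpose d i"
    have z: "z permutes {1..n}"
      unfolding z_def using u(1) B(1) c(1) d(1) iN by (intro transposition_permutes) auto
    have im: "Transposition.transpose c (Suc i) ` B = B" "Transposition.transpose d i ` B = B"
      using c(1) d(2) i(2) iB by (auto simp: transpose_image_eq)
    have "z ` B = u ` B" unfolding z_def by (metis image_comp im)
    then have zB: "sum z B = \<beta>"
      using sum.reindex[OF permutes_inj_on[OF z], of id B] 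
        sum.reindex[OF permutes_inj_on[OF u(1)], of id B] u(2) by simp
    have "z i = t" "z (Suc i) = s"
      using c d i(2) iB by (auto simp: z_def Transposition.transpose_def)
    then have desc: "z (Suc i) < z i" using up(3) by simp
    let ?y = "z \<circ> Transposition.transpose i (Suc i)"
    have "bruhat_le n ?y z" using adjacent_swap_bruhat_le[OF z i(1) _ desc] iN by simp
    moreover have "?y permutes {1..n}" using transposition_permutes[OF z iN] .
    ultimately have "sum ?y B \<le> \<beta>" using lower[of ?y z] zB by blast
    moreover have "sum ?y (B - {Suc i}) = sum z (B - {Suc i})"
      using iB by (intro sum.cong) (auto simp: Transposition.transpose_def)
    moreover have "finite B" using B(1) finite_subset by blast
    ultimately have "z i \<le> z (Suc i)" using i(2) zB by (simp add: sum.remove)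
    then show False using desc by simp
  qed
qed

lemma BIP_halves_hyperplane:
  fixes F G :: "(real ^ 'n::finite) set"
  assumes n: "n \<ge> 3" and e: "bij_betw e {1..n} (UNIV :: 'n set)"
    and F: "polytope F" "F = bruhat_interval_polytope n e id v"
    and G: "polytope G" "G = bruhat_interval_polytope n e u w"
    and union: "permutahedron n e = F \<union> G" and face: "F \<inter> G face_of F"
    and ne: "\<not> F \<subseteq> G" "\<not> G \<subseteq> F"
  shows "\<exists>(a, b) \<in> hyperplanes_T1 n e \<union> hyperplanes_T2 n e \<union> hyperplanes_T3 n e.
    {F, G} = {permutahedron n e \<inter> {x. a \<bullet> x \<ge> b}, permutahedron n e \<inter> {x. a \<bullet> x \<le> b}}"
proof -
  let ?P = "permutahedron n e"
  define I where "I = bruhat_interval n id v"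
  define J where "J = bruhat_interval n u w"
  have FI: "F = convex hull (perm_point n e ` I)" and GJ: "G = convex hull (perm_point n e ` J)"
    using F(2) G(2) by (simp_all add: I_def J_def bruhat_interval_polytope_def)
  have convP: "convex ?P" by (simp add: permutahedron_def)
  obtain a b p q where ab: "F = ?P \<inter> {x. a \<bullet> x \<le> b}" "G = ?P \<inter> {x. a \<bullet> x \<ge> b}"
    and pq: "p \<in> ?P" "a \<bullet> p < b" "q \<in> ?P" "a \<bullet> q > b"
    using convex_union_split_by_hyperplane[OF convP union F(1) polytope_imp_closed[OF G(1)] face ne]
    by metis
  obtain B \<beta> where B: "B \<subseteq> {1..n}" "B \<noteq> {}" "B \<noteq> {1..n}"
    and Fb: "F = ?P \<inter> {x. block_vec e B \<bullet> x \<le> real \<beta>}"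
    and Gb: "G = ?P \<inter> {x. block_vec e B \<bullet> x \<ge> real \<beta>}"
    and u\<beta>: "sum u B = \<beta>" and uIJ: "u \<in> I \<inter> J" and im: "\<And>z. z \<in> I \<inter> J \<Longrightarrow> z ` B = u ` B"
    and lo: "\<exists>z. z permutes {1..n} \<and> sum z B < \<beta>" and hi: "\<exists>z. z permutes {1..n} \<and> sum z B > \<beta>"
    using BIP_halves_by_block[OF e I_def J_def refl FI GJ face ab pq] by metis
  have perm_P: "perm_point n e z \<in> ?P" if "z permutes {1..n}" for z
    using that unfolding permutahedron_def by (simp add: hull_inc)
  have IS: "I \<subseteq> {z. z permutes {1..n}}" and JS: "J \<subseteq> {z. z permutes {1..n}}"
    unfolding I_def J_def bruhat_interval_def bruhat_le_def by auto
  have memI: "z \<in> I \<longleftrightarrow> sum z B \<le> \<beta>" if "z permutes {1..n}" for z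
    using perm_point_in_hull_iff[OF e that IS] perm_P[OF that] inner_block_vec_perm_point[OF e B(1), of z]
    unfolding FI[symmetric] by (simp add: Fb del: of_nat_sum)
  have memJ: "z \<in> J \<longleftrightarrow> sum z B \<ge> \<beta>" if "z permutes {1..n}" for z
    using perm_point_in_hull_iff[OF e that JS] perm_P[OF that] inner_block_vec_perm_point[OF e B(1), of z]
    unfolding GJ[symmetric] by (simp add: Gb del: of_nat_sum)
  have u: "u permutes {1..n}" using uIJ IS by blast
  have finB: "finite B" using B(1) finite_subset by blast
  have sum_image: "sum z B = \<Sum>(z ` B)" and card_image: "card (z ` B) = card B"
    and image_sub: "z ` B \<subseteq> {1..n}" if "z permutes {1..n}" for z
    using that B(1) permutes_image[OF that]
    by (auto simp: sum.reindex[OF permutes_inj_on] card_image[OF permutes_inj_on])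
  \<comment> \<open>A permutation with block sum \<open>\<beta>\<close> lies in both intervals, so its values on \<open>B\<close> are those of \<open>u\<close>.\<close>
  define S where "S = u ` B"
  have S: "S \<subseteq> {1..n}" "finite S" "card S = card B" "\<Sum>S = \<beta>"
    using sum_image[OF u] card_image[OF u] image_sub[OF u] finB u\<beta> by (auto simp: S_def)
  have uniq: "\<forall>T\<subseteq>{1..n}. card T = card S \<longrightarrow> \<Sum>T = \<Sum>S \<longrightarrow> T = S"
  proof (intro allI impI)
    fix T assume T: "T \<subseteq> {1..n}" "card T = card S" "\<Sum>T = \<Sum>S"
    then obtain z where z: "z permutes {1..n}" "z ` B = T"
      using permutes_with_image[of "{1..n}" B T] B(1) S(3) by auto
    then have "sum z B = \<beta>" using sum_image T(3) S(4) by simp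
    then show "T = S" using im[of z] memI[OF z(1)] memJ[OF z(1)] z(2) by (simp add: S_def)
  qed
  obtain zl where zl: "zl permutes {1..n}" "sum zl B < \<beta>" using lo by blast
  obtain zh where zh: "zh permutes {1..n}" "sum zh B > \<beta>" using hi by blast
  have "\<exists>s\<in>S - zh ` B. \<exists>t\<in>zh ` B - S. s < t"
    using zh S finB sum_image[OF zh(1)] card_image[OF zh(1)] by (intro sum_less_imp_exchange) auto
  then obtain s t where up: "s \<in> S" "t \<notin> S" "t \<in> {1..n}" "s < t"
    using image_sub[OF zh(1)] by blast
  have "\<exists>t\<in>zl ` B - S. \<exists>s\<in>S - zl ` B. t < s"
    using zl S finB sum_image[OF zl(1)] card_image[OF zl(1)] by (intro sum_less_imp_exchange) auto
  then obtain s' t' where dn: "s' \<in> S" "t' \<notin> S" "t' \<in> {1..n}" "t' < s'"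
    using image_sub[OF zl(1)] by blast
  have lower: "sum y B \<le> \<beta>" 
    if "y permutes {1..n}" "sum z B \<le> \<beta>" "bruhat_le n y z" for y z
  proof -
    have "z permutes {1..n}" using that(3) by (simp add: bruhat_le_def)
    then have "z \<in> I" using memI that(2) by blast
    then have "y \<in> I"
      using that(1,3) id_bruhat_le bruhat_le_trans unfolding I_def bruhat_interval_def by blast
    then show ?thesis using memI that(1) by blast
  qed
  define j where "j = card B"
  have Bj: "B = {1..j}"
    unfolding j_def
  proof (rule BIP_halves_block_initial[of B n \<beta> u s t])
    show "sum y B \<le> \<beta>"
      if "y permutes {1..n}" "sum z B \<le> \<beta>" "bruhat_le n y z" for y z
      using lower[OF that] .
    show "s \<in> u ` B" "t \<in> {1..n} - u ` B" using up by (simp_all add: S_def)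
  qed (fact B u u\<beta> up)+
  have j1: "1 \<le> j" using B(2) finB by (simp add: j_def Suc_le_eq card_gt_0_iff)
  have "card B < n" using psubset_card_mono[of "{1..n}" B] B by auto
  then have jn: "j \<le> n - 1" by (simp add: j_def)
  have FG: "{F, G} = {?P \<inter> {x. block_vec e B \<bullet> x \<ge> real \<beta>}, ?P \<inter> {x. block_vec e B \<bullet> x \<le> real \<beta>}}"
    using Fb Gb by blast
  have vec: "block_vec e B = (\<Sum>i\<in>{1..j}. axis (e i) 1)" by (simp add: block_vec_def Bj)
  have range: "i \<in> {1..n} \<Longrightarrow> 1 \<le> z i \<and> z i \<le> n" if "z permutes {1..n}" for z i
    using permutes_in_image[OF that, of i] by auto
  consider "j = 1" | "j = n - 1" | "2 \<le> j" "j \<le> n - 2" using j1 jn by linarith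
  then show ?thesis
  proof cases
    case 1
    have "2 \<le> \<beta>" "\<beta> \<le> n - 1"
      using zl zh 1 Bj range[OF zl(1), of 1] range[OF zh(1), of 1] n by auto
    then have "(block_vec e B, real \<beta>) \<in> hyperplanes_T3 n e"
      unfolding hyperplanes_T3_def vec 1 by auto
    then show ?thesis using FG by blast
  next
    case 2
    have compl: "{1..n} - B = {n}" using 2 Bj n by auto
    have tot: "sum z B + z n = \<Sum>{1..n}" if "z permutes {1..n}" for z
      using sum.permute[OF that, of id] sum.subset_diff[OF B(1), of z] compl by simp
    \<comment> \<open>The block omits only position \<open>n\<close>, so its sum is complementary to the last coordinate.\<close>
    define r where "r = u n"
    have "z n < r" if "z permutes {1..n}" "sum z B > \<beta>" for z
      using tot[OF that(1)] tot[OF u] that(2) u\<beta> by (simp add: r_def)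
    moreover have "r < z n" if "z permutes {1..n}" "sum z B < \<beta>" for z
      using tot[OF that(1)] tot[OF u] that(2) u\<beta> by (simp add: r_def)
    ultimately have "zh n < r" "r < zl n" using zh zl by blast+
    then have r: "2 \<le> r" "r \<le> n - 1"
      using range[OF zh(1), of n] range[OF zl(1), of n] n by auto
    have "real \<beta> + real r = real (\<Sum>{1..n})"
      using tot[OF u] u\<beta> by (metis r_def of_nat_add)
    moreover have "block_vec e {n} \<bullet> x = real (\<Sum>{1..n}) - block_vec e B \<bullet> x" if "x \<in> ?P" for x
      using block_vec_inner_complement[OF e that B(1)] unfolding compl .
    ultimately have "?P \<inter> {x. block_vec e B \<bullet> x \<ge> real \<beta>} = ?P \<inter> {x. block_vec e {n} \<bullet> x \<le> real r}"
      "?P \<inter> {x. block_vec e B \<bullet> x \<le> real \<beta>} = ?P \<inter> {x. block_vec e {n} \<bullet> x \<ge> real r}"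
      by force+
    then have "{F, G} = {?P \<inter> {x. block_vec e {n} \<bullet> x \<ge> real r}, ?P \<inter> {x. block_vec e {n} \<bullet> x \<le> real r}}"
      using FG by (simp add: insert_commute)
    moreover have "(block_vec e {n}, real r) \<in> hyperplanes_T3 n e"
      unfolding hyperplanes_T3_def block_vec_def using r by auto
    ultimately show ?thesis by blast
  next
    case 3
    then have cS: "2 \<le> card S" "card S \<le> n - 2" using S(3) by (simp_all add: j_def)
    have Sj: "card S = j" using S(3) by (simp add: j_def)
    consider "S = {1..j - 1} \<union> {j + 1}" | "S = {n - j} \<union> {n - j + 2..n}"
      using unique_subset_of_sum[OF S(1) uniq cS up dn] unfolding Sj by blast
    then show ?thesis
    proof cases
      case 1
      have "\<Sum>{1..j} = (j + 1) choose 2"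
        using gauss_sum_from_Suc_0[of j, where 'a = nat] by (simp add: choose_two mult.commute)
      moreover have "\<Sum>{1..j} = \<Sum>{1..j - 1} + j" using j1 by (cases j) auto
      moreover have "\<Sum>S = \<Sum>{1..j - 1} + (j + 1)" using j1 unfolding 1 by (subst sum.union_disjoint) auto
      ultimately have "real \<beta> = real ((j + 1) choose 2) + 1" using S(4) by simp
      then have "(block_vec e B, real \<beta>) \<in> hyperplanes_T1 n e"
        unfolding hyperplanes_T1_def vec using 3 by auto
      then show ?thesis using FG by blast
    next
      case 2
      have "real \<beta> = (\<Sum>k\<in>{n - j} \<union> {n - j + 2..n}. real k)" using S(4) 2 by (simp flip: of_nat_sum)
      then have "(block_vec e B, real \<beta>) \<in> hyperplanes_T2 n e"
        unfolding hyperplanes_T2_def vec using 3 by auto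
      then show ?thesis using FG by blast
    qed
  qed
qed

lemma cells_covered_by_maximal_cells:
  assumes "finite \<C>"
  shows "\<Union>(maximal_cells \<C>) = \<Union>\<C>"
proof
  show "\<Union>\<C> \<subseteq> \<Union>(maximal_cells \<C>)"
  proof
    fix x assume "x \<in> \<Union>\<C>"
    then obtain S where S: "S \<in> \<C>" "x \<in> S" by blast
    obtain M where "M \<in> \<C>" "S \<subseteq> M" "\<forall>T\<in>\<C>. M \<subseteq> T \<longrightarrow> M = T"
      using finite_has_maximal2[OF assms S(1)] by blast
    then show "x \<in> \<Union>(maximal_cells \<C>)" using S(2) by (auto simp: maximal_cells_def)
  qed
qed (auto simp: maximal_cells_def)

theorem theorem4p11:
  fixes n :: nat
    and e :: "nat \<Rightarrow> 'n::finite"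
    and \<C> :: "(real ^ 'n) set set"
    and F\<^sub>1 F\<^sub>2 :: "(real ^ 'n) set"
  assumes "n \<ge> 3"
    and "bij_betw e {1..n} (UNIV :: 'n set)"
    and "is_split \<C> (permutahedron n e)"
    and "maximal_cells \<C> = {F\<^sub>1, F\<^sub>2}"
    and "is_BIP n e F\<^sub>1" and "is_BIP n e F\<^sub>2"
  shows "\<exists>(a, b) \<in> hyperplanes_T1 n e \<union> hyperplanes_T2 n e \<union> hyperplanes_T3 n e.
           {F\<^sub>1, F\<^sub>2} = {permutahedron n e \<inter> {x. a \<bullet> x \<ge> b}, permutahedron n e \<inter> {x. a \<bullet> x \<le> b}}"
proof -
  have cpx: "polytopal_complex \<C>" and un: "\<Union>\<C> = permutahedron n e" 
    and two: "card (maximal_cells \<C>) = 2"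
    using assms(3) by (auto simp: is_split_def polytopal_subdivision_def)
  have cells: "F\<^sub>1 \<in> \<C>" "F\<^sub>2 \<in> \<C>" and F12: "F\<^sub>1 \<noteq> F\<^sub>2" 
    using assms(4) two by (auto simp: maximal_cells_def)
  have "F\<^sub>1 \<in> maximal_cells \<C>" "F\<^sub>2 \<in> maximal_cells \<C>" using assms(4) by simp_all
  then have ne: "\<not> F\<^sub>1 \<subseteq> F\<^sub>2" "\<not> F\<^sub>2 \<subseteq> F\<^sub>1"
    using F12 cells by (auto simp: maximal_cells_def)
  have union: "permutahedron n e = F\<^sub>1 \<union> F\<^sub>2"
    using cells_covered_by_maximal_cells[of \<C>] cpx un assms(4) by (simp add: polytopal_complex_def)
  have poly: "polytope F\<^sub>1" "polytope F\<^sub>2"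
    and face: "F\<^sub>1 \<inter> F\<^sub>2 face_of F\<^sub>1" "F\<^sub>1 \<inter> F\<^sub>2 face_of F\<^sub>2"
    using cpx cells unfolding polytopal_complex_def by blast+
  \<comment> \<open>The conclusion is symmetric in the cells, so the one containing the identity may come first;
    the identity is the least element of the Bruhat order, hence of the interval of that cell.\<close>
  have core: "\<exists>(a, b) \<in> hyperplanes_T1 n e \<union> hyperplanes_T2 n e \<union> hyperplanes_T3 n e.
      {F, G} = {permutahedron n e \<inter> {x. a \<bullet> x \<ge> b}, permutahedron n e \<inter> {x. a \<bullet> x \<le> b}}"
    if FG: "polytope F" "polytope G" "permutahedron n e = F \<union> G" "F \<inter> G face_of F"
      "\<not> F \<subseteq> G" "\<not> G \<subseteq> F" "is_BIP n e F" "is_BIP n e G" and id: "perm_point n e id \<in> F" for F G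
  proof -
    obtain u v where F: "F = bruhat_interval_polytope n e u v" using FG(7) by (auto simp: is_BIP_def)
    have "bruhat_interval n u v \<subseteq> {z. z permutes {1..n}}"
      by (auto simp: bruhat_interval_def bruhat_le_def)
    then have "id \<in> bruhat_interval n u v"
      using perm_point_in_hull_iff[OF assms(2) permutes_id] id
      unfolding F bruhat_interval_polytope_def by blast
    then have "u = id" using bruhat_le_id by (auto simp: bruhat_interval_def)
    then have F': "F = bruhat_interval_polytope n e id v" using F by simp
    obtain u' w where G: "G = bruhat_interval_polytope n e u' w" using FG(8) by (auto simp: is_BIP_def)
    show ?thesis
      using BIP_halves_hyperplane[OF assms(1,2) FG(1) F' FG(2) G FG(3-6)] .
  qed
  have "perm_point n e id \<in> F\<^sub>1 \<union> F\<^sub>2"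
    unfolding union[symmetric] permutahedron_def by (simp add: hull_inc permutes_id)
  then show ?thesis
  proof
    assume "perm_point n e id \<in> F\<^sub>1"
    then show ?thesis using poly union face ne assms(5,6) by (intro core)
  next
    assume "perm_point n e id \<in> F\<^sub>2"
    then have "\<exists>(a, b) \<in> hyperplanes_T1 n e \<union> hyperplanes_T2 n e \<union> hyperplanes_T3 n e.
      {F\<^sub>2, F\<^sub>1} = {permutahedron n e \<inter> {x. a \<bullet> x \<ge> b}, permutahedron n e \<inter> {x. a \<bullet> x \<le> b}}"
      using poly union face ne assms(5,6) by (intro core) (simp_all add: Un_commute Int_commute)
    then show ?thesis by (simp add: insert_commute)
  qed
qed

end
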